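(* Let $G$ be a graph and $v$ a vertex of $G$. Then $G$ is a core graph if and only if its Fowler Construction $F(G,v)$ is a core graph. Moreover, $\eta(G)=\eta(F(G,v))$.
   Context: All graphs are finite and simple. For a graph $G$ with 0--1 adjacency matrix $\mathbf{A}(G)$, the nullity $\eta(G)$ is the multiplicity of $0$ as an eigenvalue of $\mathbf{A}(G)$. A vertex is a core vertex if it corresponds to a nonzero entry of some vector in $\ker \mathbf{A}(G)$; a core graph is a singular graph all of whose vertices are core vertices. Fowler Construction: let $v$ have degree $\rho$ with neighbours $u_1,\dots,u_\rho$. The graph $F(G,v)$ is obtained from $G$ by adding $2\rho$ new vertices $p_1,\dots,p_\rho,q_1,\dots,q_\rho$; for each $i$, deleting the edge $vu_i$ and adding edges $vq_i$ and $p_iu_i$; and finally adding the edges $p_iq_j$ for all $i,j\in\{1,\dots,\rho\}$ with $i\neq j$. *)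

theory Defs
  imports
    "Graph_Theory.Pair_Digraph"
    "Jordan_Normal_Form.Char_Poly"
    "Jordan_Normal_Form.Matrix_Kernel"
begin

text \<open>
  A finite simple graph is a \<open>pair_graph\<close>: finite, loop-free, with a symmetric arc relation (an
  edge is a pair of opposite arcs) and hence without parallel edges.

  Rows and columns of the adjacency matrix follow an arbitrary but fixed enumeration of the
  vertices. Another enumeration conjugates the matrix by a permutation matrix, so neither the
  nullity nor the set of core vertices depends on the choice.
\<close>

definition vertex_list :: "'a pair_pre_digraph \<Rightarrow> 'a list" where
  "vertex_list G = (SOME vs. distinct vs \<and> set vs = pverts G)"

lemma vertex_list:
  assumes "finite (pverts G)"
  shows "distinct (vertex_list G)" and "set (vertex_list G) = pverts G"
proof -
  have "\<exists>vs. distinct vs \<and> set vs = pverts G"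
    using finite_distinct_list[OF assms] by blast
  from someI_ex[OF this] show "distinct (vertex_list G)" "set (vertex_list G) = pverts G"
    unfolding vertex_list_def by blast+
qed

definition adjacency_matrix :: "'a pair_pre_digraph \<Rightarrow> real mat" where
  "adjacency_matrix G =
     (let vs = vertex_list G
      in mat (length vs) (length vs) (\<lambda>(i, j). if (vs ! i, vs ! j) \<in> parcs G then 1 else 0))"

definition nullity :: "'a pair_pre_digraph \<Rightarrow> nat" where
  "nullity G = Polynomial.order 0 (char_poly (adjacency_matrix G))"

definition core_vertex :: "'a pair_pre_digraph \<Rightarrow> 'a \<Rightarrow> bool" where
  "core_vertex G w \<longleftrightarrow>
     (\<exists>x \<in> mat_kernel (adjacency_matrix G).
        \<exists>i < length (vertex_list G). vertex_list G ! i = w \<and> x $ i \<noteq> 0)"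

definition core_graph :: "'a pair_pre_digraph \<Rightarrow> bool" where
  "core_graph G \<longleftrightarrow> nullity G > 0 \<and> (\<forall>w \<in> pverts G. core_vertex G w)"

text \<open>
  The new vertices \<open>p\<^sub>i\<close> and \<open>q\<^sub>i\<close> are labelled by the neighbour \<open>u\<^sub>i\<close> of \<open>v\<close> rather than by its
  index; \<open>P u\<close> and \<open>Q u\<close> with \<open>u\<close> not a neighbour of \<open>v\<close> are not vertices of the construction.
\<close>

datatype 'a fowler_vertex = Old 'a | P 'a | Q 'a

definition neighbours :: "'a pair_pre_digraph \<Rightarrow> 'a \<Rightarrow> 'a set" where
  "neighbours G v = {u. (v, u) \<in> parcs G}"

definition fowler :: "'a pair_pre_digraph \<Rightarrow> 'a \<Rightarrow> 'a fowler_vertex pair_pre_digraph" where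
  "fowler G v =
     (let N = neighbours G v;
          kept = {(Old a, Old b) | a b.
                    (a, b) \<in> parcs G - ({v} \<times> N) - (N \<times> {v})};
          new = {(Old v, Q u) | u. u \<in> N}
              \<union> {(P u, Old u) | u. u \<in> N}
              \<union> {(P u, Q w) | u w. u \<in> N \<and> w \<in> N \<and> u \<noteq> w}
      in \<lparr> pverts = Old ` pverts G \<union> P ` N \<union> Q ` N,
           parcs = kept \<union> new \<union> new\<inverse> \<rparr>)"

lemma pair_graph_fowler:
  assumes "pair_graph G" and "v \<in> pverts G"
  shows "pair_graph (fowler G v)"
proof -
  interpret pair_graph G by fact
  have N: "neighbours G v \<subseteq> pverts G"
    by (auto simp: neighbours_def dest: in_arcsD2)
  have fin: "finite (pverts (fowler G v))"
    using pair_finite_verts finite_subset[OF N pair_finite_verts]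
    by (simp add: fowler_def Let_def)
  have sub: "parcs (fowler G v) \<subseteq> pverts (fowler G v) \<times> pverts (fowler G v)"
    using N assms(2) by (auto simp: fowler_def Let_def dest: in_arcsD1 in_arcsD2)
  have sym_G: "(b, a) \<in> parcs G" if "(a, b) \<in> parcs G" for a b
    using pair_sym_arcs that by (auto simp: symmetric_def elim: symE)
  have "sym (parcs (fowler G v))"
    by (rule symI) (auto simp: fowler_def Let_def intro: sym_G)
  moreover have "fst e \<noteq> snd e" if "e \<in> parcs (fowler G v)" for e
    using that pair_no_loops by (fastforce simp: fowler_def Let_def)
  moreover have "finite (parcs (fowler G v))"
    using finite_subset[OF sub] fin by blast
  ultimately show ?thesis
    using fin sub by unfold_locales (auto simp: symmetric_def)
qed

end

theory Submission
  imports
    Defs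
    "Jordan_Normal_Form.Jordan_Normal_Form_Uniqueness"
    "Jordan_Normal_Form.Jordan_Normal_Form_Existence"
begin

text \<open>
  A null weighting \<open>f\<close> of \<open>G\<close> (the weights around each vertex sum to zero) induces one of
  \<open>F(G,v)\<close>: put \<open>f v\<close> on each \<open>p\<^sub>i\<close>, \<open>f u\<^sub>i\<close> on \<open>q\<^sub>i\<close>, \<open>(1 - \<rho>) f v\<close> on \<open>v\<close>, and keep \<open>f\<close>
  elsewhere. The equations at the \<open>p\<^sub>i\<close>, the \<open>q\<^sub>i\<close> and \<open>v\<close> force every null weighting of
  \<open>F(G,v)\<close> to have this form, so this is a linear isomorphism of kernels. It preserves coreness
  unless \<open>\<rho> = 1\<close>, and then the neighbour of \<open>v\<close> is not a core vertex of \<open>G\<close> and \<open>v\<close> is not one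
  of \<open>F(G,v)\<close>.

  Nullity is an algebraic multiplicity. A Hermitian matrix has \<open>ker A\<^sup>2 = ker A\<close>, so its Jordan
  blocks for \<open>0\<close> have size one and the multiplicity is the dimension of the kernel.
\<close>

section \<open>Kernels and algebraic multiplicities\<close>

text \<open>Linearity is demanded on the kernel of \<open>A\<close> only, so the behaviour of
  \<open>T\<close> on other vectors is irrelevant.\<close>

lemma kernel_dim_eq_linear_bij:
  fixes A B :: "'k :: field mat"
  assumes A: "A \<in> carrier_mat nr nc" and B: "B \<in> carrier_mat mr mc"
    and bij: "bij_betw T (mat_kernel A) (mat_kernel B)"
    and add: "\<And>x y. x \<in> mat_kernel A \<Longrightarrow> y \<in> mat_kernel A \<Longrightarrow> T (x + y) = T x + T y"
    and smult: "\<And>c x. x \<in> mat_kernel A \<Longrightarrow> T (c \<cdot>\<^sub>v x) = c \<cdot>\<^sub>v T x"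
  shows "kernel_dim A = kernel_dim B"
proof -
  interpret KA: kernel nr nc A by unfold_locales fact
  interpret KB: kernel mr mc B by unfold_locales fact
  have inj: "inj_on T (mat_kernel A)" and im: "T ` mat_kernel A = mat_kernel B"
    using bij by (auto simp: bij_betw_def)
  interpret L: linear_map class_ring KA.VK KB.VK T
    by unfold_locales (use im add smult in \<open>auto simp: module_hom_def class_ring_simps module_vec_simps\<close>)
  obtain b where "finite b" "KA.basis b"
    using kernel_basis_exists[OF A] by blast
  then have "KA.Ker.fin_dim"
    unfolding KA.Ker.fin_dim_def KA.Ker.basis_def by auto
  from L.dim_eq[OF this] inj im show ?thesis
    by simp
qed

text \<open>Moving one factor \<open>A\<close> across the Hermitian inner product gives <A w, A w> =
  <w, A (A w)> = 0, and that product is definite.\<close>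

lemma hermitian_mat_kernel_square:
  fixes A :: "complex mat"
  assumes A: "A \<in> carrier_mat n n"
    and herm: "\<And>i j. i < n \<Longrightarrow> j < n \<Longrightarrow> A $$ (j, i) = cnj (A $$ (i, j))"
    and w: "w \<in> carrier_vec n" and zero: "A *\<^sub>v (A *\<^sub>v w) = 0\<^sub>v n"
  shows "A *\<^sub>v w = 0\<^sub>v n"
proof -
  have y: "A *\<^sub>v w \<in> carrier_vec n" using A w by simp
  \<comment> \<open>The entrywise conjugate of a Hermitian matrix is its transpose, and a transpose
    can be moved across the bilinear scalar product.\<close>
  have "conjugate (A *\<^sub>v w) = transpose_mat A *\<^sub>v conjugate w"
  proof (rule eq_vecI)
    fix i assume "i < dim_vec (transpose_mat A *\<^sub>v conjugate w)"
    then have i: "i < n" using A by simp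
    have "conjugate (A *\<^sub>v w) $ i = (\<Sum>j = 0..<n. cnj (A $$ (i, j)) * cnj (w $ j))"
      using A w i by (simp add: scalar_prod_def)
    also have "\<dots> = (\<Sum>j = 0..<n. A $$ (j, i) * cnj (w $ j))"
      by (intro sum.cong refl) (simp add: herm[OF i])
    also have "\<dots> = (transpose_mat A *\<^sub>v conjugate w) $ i"
      using A w i by (simp add: scalar_prod_def)
    finally show "conjugate (A *\<^sub>v w) $ i = (transpose_mat A *\<^sub>v conjugate w) $ i" .
  qed (use A in simp)
  then have "(A *\<^sub>v w) \<bullet>c (A *\<^sub>v w) = (A *\<^sub>v w) \<bullet> (transpose_mat A *\<^sub>v conjugate w)"
    by simp
  also have "\<dots> = (transpose_mat A *\<^sub>v conjugate w) \<bullet> (A *\<^sub>v w)"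
    using A w by (intro comm_scalar_prod[of _ n]) auto
  also have "\<dots> = conjugate w \<bullet> (A *\<^sub>v (A *\<^sub>v w))"
    using A w by (intro transpose_vec_mult_scalar[of _ n n]) auto
  also have "\<dots> = 0" using w by (simp add: zero)
  finally show ?thesis using conjugate_square_eq_0_vec[OF y] by simp
qed

text \<open>Split off the innermost factor: by induction \<open>A *\<^sub>v x\<close> lies in the
  kernel of \<open>A\<close>, and the previous lemma removes the remaining square. The exponent is a
  successor because \<open>A ^\<^sub>m 0\<close> is the identity.\<close>

lemma hermitian_mat_kernel_pow:
  fixes A :: "complex mat"
  assumes A: "A \<in> carrier_mat n n"
    and herm: "\<And>i j. i < n \<Longrightarrow> j < n \<Longrightarrow> A $$ (j, i) = cnj (A $$ (i, j))"
  shows "mat_kernel (A ^\<^sub>m Suc k) = mat_kernel A"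
proof (induction k)
  case 0
  show ?case using A by simp
next
  case (Suc k)
  have Ak: "A ^\<^sub>m Suc k \<in> carrier_mat n n" using A by (rule pow_carrier_mat)
  have "x \<in> mat_kernel (A ^\<^sub>m Suc (Suc k)) \<longleftrightarrow> x \<in> mat_kernel (A ^\<^sub>m Suc k)" for x
  proof (cases "x \<in> carrier_vec n")
    case True
    have Ax: "A *\<^sub>v x \<in> carrier_vec n" using A True by simp
    have "x \<in> mat_kernel (A ^\<^sub>m Suc (Suc k)) \<longleftrightarrow> A ^\<^sub>m Suc k *\<^sub>v (A *\<^sub>v x) = 0\<^sub>v n"
      unfolding pow_mat.simps(2)[of A "Suc k"]
      using Ak A True mat_kernel[OF mult_carrier_mat[OF Ak A]] assoc_mult_mat_vec[OF Ak A True]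
      by auto
    also have "\<dots> \<longleftrightarrow> A *\<^sub>v x \<in> mat_kernel A"
      using Suc Ax mat_kernel[OF Ak] by auto
    also have "\<dots> \<longleftrightarrow> A *\<^sub>v (A *\<^sub>v x) = 0\<^sub>v n"
      using Ax mat_kernel[OF A] by auto
    also have "\<dots> \<longleftrightarrow> A *\<^sub>v x = 0\<^sub>v n"
      using hermitian_mat_kernel_square[OF A herm True] A by auto
    also have "\<dots> \<longleftrightarrow> x \<in> mat_kernel A"
      using True mat_kernel[OF A] by auto
    finally show ?thesis using Suc by simp
  next
    case False
    then show ?thesis using mat_kernel_carrier[of _ n n] A by (meson pow_carrier_mat subsetD)
  qed
  then show ?case using Suc by blast
qed

text \<open>Over the complex numbers the characteristic polynomial splits, so a Jordan normal form
  exists. The order of the root 0 is the total size of its blocks, which is the dimension of the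
  generalized eigenspace for a large exponent.\<close>

lemma order_char_poly_hermitian:
  fixes A :: "complex mat"
  assumes A: "A \<in> carrier_mat n n"
    and herm: "\<And>i j. i < n \<Longrightarrow> j < n \<Longrightarrow> A $$ (j, i) = cnj (A $$ (i, j))"
  shows "Polynomial.order 0 (char_poly A) = kernel_dim A"
proof -
  obtain as where "char_poly A = (\<Prod>a\<leftarrow>as. [:- a, 1:])"
    using char_poly_factorized[OF A] by blast
  then obtain n_as where jnf: "jordan_nf A n_as"
    using jordan_nf_exists[OF A] by blast
  define ns where "ns = map fst [(n, e) \<leftarrow> n_as. e = 0]"
  \<comment> \<open>At the eigenvalue 0 the generalized eigenspaces are kernels of powers of
    \<open>A\<close> itself, so every positive exponent gives the same dimension.\<close>
  have "char_matrix A 0 = A"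
    using A by (auto simp: char_matrix_def)
  then have dim: "dim_gen_eigenspace A 0 (Suc k) = kernel_dim A" for k
    unfolding dim_gen_eigenspace_def kernel_dim_def
    using hermitian_mat_kernel_pow[OF A herm, of k] A by simp
  \<comment> \<open>The exponent exceeds every block size, so all blocks are exhausted.\<close>
  define N where "N = sum_list ns"
  have "Polynomial.order 0 (char_poly A) = sum_list ns"
    unfolding jordan_nf_order[OF jnf] ns_def by (simp add: case_prod_unfold)
  also have "\<dots> = (\<Sum>n\<leftarrow>ns. min (Suc N) n)"
  proof -
    have "map (min (Suc N)) ns = ns"
      unfolding N_def by (intro map_idI) (use member_le_sum_list[of _ ns] in force)
    then show ?thesis by simp
  qed
  also have "\<dots> = dim_gen_eigenspace A 0 (Suc N)"
    unfolding dim_gen_eigenspace[OF jnf] ns_def by simp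
  finally show ?thesis using dim by simp
qed

section \<open>Kernel vectors as weightings of the vertices\<close>

text \<open>Functions on vertices keep the enumeration out of the graph arguments. The value type is
  open because core vertices use real weights and the nullity complex ones.\<close>

definition null_weight :: "'a pair_pre_digraph \<Rightarrow> ('a \<Rightarrow> 'k :: comm_monoid_add) \<Rightarrow> bool" where
  "null_weight G f \<longleftrightarrow> (\<forall>w \<in> pverts G. (\<Sum>u \<in> neighbours G w. f u) = 0)"

definition weight_vec :: "'a pair_pre_digraph \<Rightarrow> ('a \<Rightarrow> 'k) \<Rightarrow> 'k vec" where
  "weight_vec G f = vec (length (vertex_list G)) (\<lambda>i. f (vertex_list G ! i))"

text \<open>Off the vertex set the chosen index is unspecified, so this inverts
  \<open>weight_vec\<close> only up to agreement on the vertices.\<close>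

definition vec_weight :: "'a pair_pre_digraph \<Rightarrow> 'k vec \<Rightarrow> 'a \<Rightarrow> 'k" where
  "vec_weight G x w = x $ (SOME i. i < length (vertex_list G) \<and> vertex_list G ! i = w)"

definition adjacency_matrix_of :: "'a pair_pre_digraph \<Rightarrow> 'k :: real_field mat" where
  "adjacency_matrix_of G = map_mat of_real (adjacency_matrix G)"

lemma adjacency_matrix_carrier:
  "adjacency_matrix G \<in> carrier_mat (length (vertex_list G)) (length (vertex_list G))"
  by (simp add: adjacency_matrix_def Let_def)

lemma adjacency_matrix_of_carrier:
  "adjacency_matrix_of G \<in> carrier_mat (length (vertex_list G)) (length (vertex_list G))"
  by (simp add: adjacency_matrix_of_def adjacency_matrix_carrier)

lemma adjacency_matrix_of_real: "adjacency_matrix_of G = adjacency_matrix G"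
  by (rule eq_matI) (simp_all add: adjacency_matrix_of_def)

lemma weight_vec_carrier: "weight_vec G f \<in> carrier_vec (length (vertex_list G))"
  by (simp add: weight_vec_def)

context pair_graph
begin

lemma neighbours_subset: "neighbours G w \<subseteq> pverts G"
  by (auto simp: neighbours_def dest: in_arcsD2)

lemma finite_neighbours: "finite (neighbours G w)"
  using neighbours_subset pair_finite_verts by (rule finite_subset)

lemma neighbours_sym: "u \<in> neighbours G w \<longleftrightarrow> w \<in> neighbours G u"
  using pair_sym_arcs by (auto simp: neighbours_def symmetric_def elim: symE)

lemma neighbours_irrefl: "w \<notin> neighbours G w"
  using pair_no_loops by (fastforce simp: neighbours_def)

lemma weight_vec_eq_iff: "weight_vec G f = weight_vec G g \<longleftrightarrow> (\<forall>w \<in> pverts G. f w = g w)"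
  unfolding vertex_list(2)[OF pair_finite_verts, symmetric]
  by (auto simp: weight_vec_def vec_eq_iff all_set_conv_all_nth)

lemma weight_vec_vec_weight:
  assumes "x \<in> carrier_vec (length (vertex_list G))"
  shows "weight_vec G (vec_weight G x) = x"
proof (rule eq_vecI)
  fix i assume "i < dim_vec x"
  then have i: "i < length (vertex_list G)" using assms by simp
  have "(SOME j. j < length (vertex_list G) \<and> vertex_list G ! j = vertex_list G ! i) = i"
    using i vertex_list(1)[OF pair_finite_verts]
    by (intro some_equality) (auto simp: nth_eq_iff_index_eq)
  then show "weight_vec G (vec_weight G x) $ i = x $ i"
    using i by (simp add: weight_vec_def vec_weight_def)
qed (use assms in \<open>simp add: weight_vec_def\<close>)

text \<open>Distinctness of \<open>vertex_list G\<close> turns the sum over column indices into a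
  sum over vertices; this is where the enumeration disappears from the kernel equation.\<close>

lemma adjacency_matrix_of_mult_weight_vec:
  "adjacency_matrix_of G *\<^sub>v weight_vec G f = weight_vec G (\<lambda>w. \<Sum>u \<in> neighbours G w. f u)"
proof (rule eq_vecI)
  let ?vs = "vertex_list G"
  fix i assume "i < dim_vec (weight_vec G (\<lambda>w. \<Sum>u \<in> neighbours G w. f u))"
  then have i: "i < length ?vs" by (simp add: weight_vec_def)
  have "(adjacency_matrix_of G *\<^sub>v weight_vec G f) $ i =
      (\<Sum>j = 0..<length ?vs. if ?vs ! j \<in> neighbours G (?vs ! i) then f (?vs ! j) else 0)"
    using i by (auto simp: adjacency_matrix_of_def adjacency_matrix_def Let_def weight_vec_def
        scalar_prod_def neighbours_def intro!: sum.cong)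
  also have "\<dots> = (\<Sum>u \<in> set ?vs. if u \<in> neighbours G (?vs ! i) then f u else 0)"
    using bij_betw_nth[OF vertex_list(1)[OF pair_finite_verts] refl refl]
    by (intro sum.reindex_bij_betw) (simp add: lessThan_atLeast0)
  also have "\<dots> = (\<Sum>u \<in> neighbours G (?vs ! i). f u)"
    using neighbours_subset[of "?vs ! i"] vertex_list(2)[OF pair_finite_verts]
    by (simp add: sum.If_cases Int_absorb1 Int_absorb2)
  finally show "(adjacency_matrix_of G *\<^sub>v weight_vec G f) $ i =
      weight_vec G (\<lambda>w. \<Sum>u \<in> neighbours G w. f u) $ i"
    using i by (simp add: weight_vec_def)
qed (simp add: adjacency_matrix_of_def adjacency_matrix_def Let_def weight_vec_def)

lemma weight_vec_in_kernel_iff: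
  fixes f :: "'a \<Rightarrow> 'k :: real_field"
  shows "weight_vec G f \<in> mat_kernel (adjacency_matrix_of G) \<longleftrightarrow> null_weight G f"
proof -
  have "0\<^sub>v (length (vertex_list G)) = weight_vec G (\<lambda>_. 0 :: 'k)"
    by (simp add: weight_vec_def zero_vec_def)
  then have "weight_vec G h = 0\<^sub>v (length (vertex_list G)) \<longleftrightarrow> (\<forall>w \<in> pverts G. h w = 0)"
    for h :: "'a \<Rightarrow> 'k"
    using weight_vec_eq_iff[of h "\<lambda>_. 0"] by simp
  then show ?thesis
    unfolding mat_kernel[OF adjacency_matrix_of_carrier] null_weight_def
    by (simp add: adjacency_matrix_of_mult_weight_vec weight_vec_carrier)
qed

lemma mat_kernel_adjacency_matrix_of:
  "mat_kernel (adjacency_matrix_of G :: 'k :: real_field mat) = weight_vec G ` {f. null_weight G f}"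
proof (intro equalityI subsetI)
  fix x :: "'k vec" assume x: "x \<in> mat_kernel (adjacency_matrix_of G)"
  then have "x = weight_vec G (vec_weight G x)"
    using mat_kernelD(1)[OF adjacency_matrix_of_carrier] weight_vec_vec_weight by metis
  with x show "x \<in> weight_vec G ` {f. null_weight G f}"
    using weight_vec_in_kernel_iff by (metis imageI mem_Collect_eq)
qed (auto simp: weight_vec_in_kernel_iff)

lemma core_vertex_iff:
  "core_vertex G w \<longleftrightarrow> w \<in> pverts G \<and> (\<exists>f :: 'a \<Rightarrow> real. null_weight G f \<and> f w \<noteq> 0)"
  unfolding core_vertex_def adjacency_matrix_of_real[symmetric] mat_kernel_adjacency_matrix_of
    vertex_list(2)[OF pair_finite_verts, symmetric]
  by (fastforce simp: weight_vec_def in_set_conv_nth)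

text \<open>Embedding the reals into the complex numbers keeps the order of the root 0, and the
  image of a real symmetric matrix is Hermitian.\<close>

lemma nullity_eq_kernel_dim:
  "nullity G = kernel_dim (adjacency_matrix_of G :: complex mat)"
proof -
  interpret poly_hom: map_poly_inj_idom_divide_hom "of_real :: real \<Rightarrow> complex" ..
  have "nullity G = Polynomial.order (complex_of_real 0) (map_poly of_real (char_poly (adjacency_matrix G)))"
    unfolding nullity_def by (rule poly_hom.order_hom[symmetric])
  also have "\<dots> = Polynomial.order 0 (char_poly (adjacency_matrix_of G :: complex mat))"
    unfolding adjacency_matrix_of_def
    by (simp add: of_real_hom.char_poly_hom[OF adjacency_matrix_carrier])
  also have "\<dots> = kernel_dim (adjacency_matrix_of G :: complex mat)"
  proof (rule order_char_poly_hermitian[OF adjacency_matrix_of_carrier])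
    fix i j assume "i < length (vertex_list G)" "j < length (vertex_list G)"
    moreover have "(a, b) \<in> parcs G \<longleftrightarrow> (b, a) \<in> parcs G" for a b
      using neighbours_sym[of a b] by (simp add: neighbours_def)
    ultimately show "adjacency_matrix_of G $$ (j, i) = cnj (adjacency_matrix_of G $$ (i, j))"
      by (simp add: adjacency_matrix_of_def adjacency_matrix_def Let_def)
  qed
  finally show ?thesis .
qed

end

text \<open>Weightings that agree on the vertices yield the same vector. Hence \<open>eq\<close>
  combines two demands modulo such agreement: \<open>\<phi>\<close> is well defined and
  injective.\<close>

lemma nullity_eq_if_null_weight_iso:
  fixes \<phi> :: "('a \<Rightarrow> complex) \<Rightarrow> 'b \<Rightarrow> complex"
  assumes G: "pair_graph G" and H: "pair_graph H"
    and null: "\<And>f. null_weight G f \<Longrightarrow> null_weight H (\<phi> f)"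
    and eq: "\<And>f g. (\<forall>w \<in> pverts H. \<phi> f w = \<phi> g w) \<longleftrightarrow> (\<forall>w \<in> pverts G. f w = g w)"
    and surj: "\<And>h. null_weight H h \<Longrightarrow> \<exists>f. null_weight G f \<and> (\<forall>w \<in> pverts H. \<phi> f w = h w)"
    and add: "\<And>f g. \<phi> (\<lambda>w. f w + g w) = (\<lambda>w. \<phi> f w + \<phi> g w)"
    and scale: "\<And>c f. \<phi> (\<lambda>w. c * f w) = (\<lambda>w. c * \<phi> f w)"
  shows "nullity G = nullity H"
proof -
  interpret G: pair_graph G by fact
  interpret H: pair_graph H by fact
  define T where "T x = weight_vec H (\<phi> (vec_weight G x))" for x
  \<comment> \<open>The weighting recovered from \<open>weight_vec G f\<close> matches
    \<open>f\<close> on the vertices only; \<open>eq\<close>, read from right to left, makes this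
    enough.\<close>
  have T: "T (weight_vec G f) = weight_vec H (\<phi> f)" for f
  proof -
    have "\<forall>w \<in> pverts G. vec_weight G (weight_vec G f) w = f w"
      using G.weight_vec_vec_weight[OF weight_vec_carrier] G.weight_vec_eq_iff by blast
    then show ?thesis by (simp add: T_def H.weight_vec_eq_iff eq)
  qed
  let ?K = "weight_vec G ` {f :: 'a \<Rightarrow> complex. null_weight G f}"
  have "kernel_dim (adjacency_matrix_of G :: complex mat) = kernel_dim (adjacency_matrix_of H :: complex mat)"
  proof (rule kernel_dim_eq_linear_bij[OF adjacency_matrix_of_carrier adjacency_matrix_of_carrier],
      unfold G.mat_kernel_adjacency_matrix_of H.mat_kernel_adjacency_matrix_of)
    have "inj_on T ?K"
      by (auto simp: inj_on_def T H.weight_vec_eq_iff G.weight_vec_eq_iff eq)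
    moreover have "T ` ?K = weight_vec H ` {h. null_weight H h}"
    proof (intro equalityI subsetI)
      fix y assume "y \<in> weight_vec H ` {h :: 'b \<Rightarrow> complex. null_weight H h}"
      then obtain h where h: "null_weight H h" and y: "y = weight_vec H h" by blast
      obtain f where f: "null_weight G f" "\<forall>w \<in> pverts H. \<phi> f w = h w" using surj[OF h] by blast
      then have "y = T (weight_vec G f)" unfolding y T H.weight_vec_eq_iff by simp
      with f show "y \<in> T ` ?K" by blast
    qed (auto simp: T null)
    ultimately show "bij_betw T ?K (weight_vec H ` {h. null_weight H h})"
      by (simp add: bij_betw_def)
  next
    fix x y assume "x \<in> ?K" "y \<in> ?K"
    then obtain f g where xy: "x = weight_vec G f" "y = weight_vec G g" by blast
    have "x + y = weight_vec G (\<lambda>w. f w + g w)"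
      unfolding xy by (auto simp: weight_vec_def)
    then have "T (x + y) = weight_vec H (\<lambda>w. \<phi> f w + \<phi> g w)" by (simp add: T add)
    also have "\<dots> = T x + T y" unfolding xy T by (auto simp: weight_vec_def)
    finally show "T (x + y) = T x + T y" .
  next
    fix c x assume "x \<in> ?K"
    then obtain f where x: "x = weight_vec G f" by blast
    have "c \<cdot>\<^sub>v x = weight_vec G (\<lambda>w. c * f w)"
      unfolding x by (auto simp: weight_vec_def)
    then have "T (c \<cdot>\<^sub>v x) = weight_vec H (\<lambda>w. c * \<phi> f w)" by (simp add: T scale)
    also have "\<dots> = c \<cdot>\<^sub>v T x" unfolding x T by (auto simp: weight_vec_def)
    finally show "T (c \<cdot>\<^sub>v x) = c \<cdot>\<^sub>v T x" .
  qed
  then show ?thesis by (simp add: G.nullity_eq_kernel_dim H.nullity_eq_kernel_dim)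
qed

section \<open>Null weightings of the Fowler construction\<close>

text \<open>The factor at \<open>Old v\<close> is forced by the equation at \<open>Q u\<close>,
  whose other neighbours are \<rho> - 1 vertices \<open>P w\<close> of weight \<open>f v\<close>.
  Subtraction takes place in the ring, so an isolated \<open>v\<close> gets the factor 1.\<close>

fun fowler_weight ::
  "'a pair_pre_digraph \<Rightarrow> 'a \<Rightarrow> ('a \<Rightarrow> 'k :: comm_ring_1) \<Rightarrow> 'a fowler_vertex \<Rightarrow> 'k" where
  "fowler_weight G v f (Old w) =
     (if w = v then (1 - of_nat (card (neighbours G v))) * f v else f w)"
| "fowler_weight G v f (P u) = f v"
| "fowler_weight G v f (Q u) = f u"

lemma pverts_fowler:
  "pverts (fowler G v) = Old ` pverts G \<union> P ` neighbours G v \<union> Q ` neighbours G v"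
  by (simp add: fowler_def Let_def)

context pair_graph
begin

lemma neighbours_fowler:
  shows "w \<noteq> v \<Longrightarrow> w \<notin> neighbours G v \<Longrightarrow>
      neighbours (fowler G v) (Old w) = Old ` neighbours G w"
    and "w \<in> neighbours G v \<Longrightarrow>
      neighbours (fowler G v) (Old w) = insert (P w) (Old ` (neighbours G w - {v}))"
    and "neighbours (fowler G v) (Old v) = Q ` neighbours G v"
    and "u \<in> neighbours G v \<Longrightarrow>
      neighbours (fowler G v) (P u) = insert (Old u) (Q ` (neighbours G v - {u}))"
    and "u \<in> neighbours G v \<Longrightarrow>
      neighbours (fowler G v) (Q u) = insert (Old v) (P ` (neighbours G v - {u}))"
  using neighbours_sym neighbours_irrefl
  by (auto simp: fowler_def Let_def neighbours_def)

text \<open>Confines the case analysis of arcs to one place. In order, the conjuncts come from old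
  vertices away from \<open>v\<close>, the neighbours of \<open>v\<close>, \<open>v\<close> itself,
  the \<open>P u\<close> and the \<open>Q u\<close>.\<close>

lemma null_weight_fowler_iff:
  fixes g :: "'a fowler_vertex \<Rightarrow> 'k :: comm_ring_1"
  assumes v: "v \<in> pverts G"
  defines "N \<equiv> neighbours G v"
  shows "null_weight (fowler G v) g \<longleftrightarrow>
    (\<forall>w \<in> pverts G - N - {v}. (\<Sum>u \<in> neighbours G w. g (Old u)) = 0) \<and>
    (\<forall>w \<in> N. g (P w) + (\<Sum>u \<in> neighbours G w - {v}. g (Old u)) = 0) \<and>
    (\<Sum>u \<in> N. g (Q u)) = 0 \<and>
    (\<forall>u \<in> N. g (Old u) + (\<Sum>w \<in> N - {u}. g (Q w)) = 0) \<and>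
    (\<forall>u \<in> N. g (Old v) + (\<Sum>w \<in> N - {u}. g (P w)) = 0)"
proof -
  have fin: "finite (neighbours G w)" for w by (rule finite_neighbours)
  have "(\<Sum>u \<in> neighbours (fowler G v) (Old w). g u) =
      (if w = v then \<Sum>u \<in> N. g (Q u)
       else if w \<in> N then g (P w) + (\<Sum>u \<in> neighbours G w - {v}. g (Old u))
       else \<Sum>u \<in> neighbours G w. g (Old u))" for w
    using fin neighbours_irrefl[of v] unfolding N_def
    by (auto simp: neighbours_fowler sum.reindex inj_on_def image_iff)
  moreover have "(\<Sum>w \<in> neighbours (fowler G v) (P u). g w) = g (Old u) + (\<Sum>w \<in> N - {u}. g (Q w))"
    and "(\<Sum>w \<in> neighbours (fowler G v) (Q u). g w) = g (Old v) + (\<Sum>w \<in> N - {u}. g (P w))"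
    if "u \<in> N" for u
    using that fin unfolding N_def
    by (auto simp: neighbours_fowler sum.reindex inj_on_def image_iff)
  moreover have "N \<subseteq> pverts G" "v \<notin> N"
    unfolding N_def by (rule neighbours_subset, rule neighbours_irrefl)
  ultimately show ?thesis
    using v by (auto simp: null_weight_def pverts_fowler ball_Un N_def[symmetric])
qed

text \<open>At a neighbour \<open>w\<close> of \<open>v\<close>, the vertex \<open>P w\<close>
  supplies the weight lost with the deleted edge. The equations at \<open>Old v\<close> and at each
  \<open>P u\<close> are both the equation of \<open>G\<close> at \<open>v\<close>; at
  \<open>Q u\<close> the multiples of \<open>f v\<close> cancel.\<close>

lemma null_weight_fowler_weight:
  fixes f :: "'a \<Rightarrow> 'k :: comm_ring_1"
  assumes v: "v \<in> pverts G" and f: "null_weight G f"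
  shows "null_weight (fowler G v) (fowler_weight G v f)"
proof -
  let ?N = "neighbours G v"
  have sum0: "(\<Sum>u \<in> neighbours G w. f u) = 0" if "w \<in> pverts G" for w
    using f that by (simp add: null_weight_def)
  have rest: "(\<Sum>u \<in> A. fowler_weight G v f (Old u)) = (\<Sum>u \<in> A. f u)" if "v \<notin> A" for A
    using that by (intro sum.cong) auto
  have fin: "finite ?N" by (rule finite_neighbours)
  show ?thesis
    unfolding null_weight_fowler_iff[OF v]
  proof (intro conjI ballI)
    fix w assume "w \<in> pverts G - ?N - {v}"
    then show "(\<Sum>u \<in> neighbours G w. fowler_weight G v f (Old u)) = 0"
      using neighbours_sym[of v w] by (simp add: rest sum0 del: fowler_weight.simps)
  next
    fix w assume w: "w \<in> ?N"
    then have "v \<in> neighbours G w" "w \<in> pverts G"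
      using neighbours_sym neighbours_subset by blast+
    then show "fowler_weight G v f (P w) +
        (\<Sum>u \<in> neighbours G w - {v}. fowler_weight G v f (Old u)) = 0"
      using sum0[of w] finite_neighbours[of w]
      by (subst rest) (simp_all add: sum.remove)
  next
    show "(\<Sum>u \<in> ?N. fowler_weight G v f (Q u)) = 0" using sum0[OF v] by simp
  next
    fix u assume u: "u \<in> ?N"
    then have "u \<noteq> v" using neighbours_irrefl by blast
    then show "fowler_weight G v f (Old u) + (\<Sum>w \<in> ?N - {u}. fowler_weight G v f (Q w)) = 0"
      using sum0[OF v] sum.remove[OF fin u, of f] by simp
    show "fowler_weight G v f (Old v) + (\<Sum>w \<in> ?N - {u}. fowler_weight G v f (P w)) = 0"
      using card.remove[OF fin u] by (simp add: algebra_simps)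
  qed
qed

lemma fowler_weight_surj:
  fixes g :: "'a fowler_vertex \<Rightarrow> 'k :: comm_ring_1"
  assumes v: "v \<in> pverts G" and g: "null_weight (fowler G v) g"
  obtains f where "null_weight G f" "\<And>w. w \<in> pverts (fowler G v) \<Longrightarrow> fowler_weight G v f w = g w"
proof -
  let ?N = "neighbours G v"
  \<comment> \<open>By the equation at \<open>Q u\<close>, this is the weight of \<open>P u\<close>
    for every neighbour \<open>u\<close>. Defined as a sum, it also makes sense when
    \<open>v\<close> is isolated, and then equals \<open>g (Old v)\<close>.\<close>
  define a where "a = g (Old v) + (\<Sum>w \<in> ?N. g (P w))"
  define f where "f w = (if w = v then a else g (Old w))" for w
  have fin: "finite ?N" by (rule finite_neighbours)
  note g = g[unfolded null_weight_fowler_iff[OF v]]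
  have P: "g (P u) = a" if "u \<in> ?N" for u
  proof -
    have "g (Old v) + (\<Sum>w \<in> ?N - {u}. g (P w)) = 0" using g that by blast
    then show ?thesis using fin that by (simp add: a_def sum.remove add.left_commute)
  qed
  \<comment> \<open>The difference of the equations at \<open>P u\<close> and
    \<open>Old v\<close>.\<close>
  have Q: "g (Q u) = g (Old u)" if "u \<in> ?N" for u
  proof -
    have "g (Old u) + (\<Sum>w \<in> ?N - {u}. g (Q w)) = 0" "(\<Sum>w \<in> ?N. g (Q w)) = 0"
      using g that by blast+
    then show ?thesis using fin that by (simp add: sum.remove add_eq_0_iff2)
  qed
  \<comment> \<open>Substituting \<open>a\<close> for each \<open>g (P w)\<close> in its own
    definition yields \<open>g (Old v)\<close> without division, so degree 1 is no
    exception.\<close>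
  have "a = g (Old v) + (\<Sum>w \<in> ?N. g (P w))" by (rule a_def)
  also have "(\<Sum>w \<in> ?N. g (P w)) = of_nat (card ?N) * a" using P by simp
  finally have "g (Old v) = a - of_nat (card ?N) * a" by (metis add_diff_cancel_right')
  then have "fowler_weight G v f w = g w" if "w \<in> pverts (fowler G v)" for w
    using that neighbours_irrefl[of v]
    by (auto simp: pverts_fowler f_def P Q algebra_simps)
  moreover have "null_weight G f"
    unfolding null_weight_def
  proof
    fix w assume w: "w \<in> pverts G"
    have rest: "(\<Sum>u \<in> A. f u) = (\<Sum>u \<in> A. g (Old u))" if "v \<notin> A" for A
      using that by (intro sum.cong) (auto simp: f_def)
    consider "w = v" | "w \<in> ?N" | "w \<noteq> v" "w \<notin> ?N" by blast
    then show "(\<Sum>u \<in> neighbours G w. f u) = 0"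
    proof cases
      case 1
      have "(\<Sum>u \<in> ?N. g (Old u)) = (\<Sum>u \<in> ?N. g (Q u))" using Q by simp
      then show ?thesis using 1 g neighbours_irrefl[of v] by (simp add: rest)
    next
      case 2
      then have "v \<in> neighbours G w" using neighbours_sym by blast
      then have "(\<Sum>u \<in> neighbours G w. f u) = f v + (\<Sum>u \<in> neighbours G w - {v}. g (Old u))"
        by (simp add: sum.remove finite_neighbours rest)
      moreover have "f v = g (P w)" using P[OF 2] by (simp add: f_def)
      ultimately show ?thesis using g 2 by simp
    next
      case 3
      then have "v \<notin> neighbours G w" using neighbours_sym by blast
      then show ?thesis using g w 3 by (simp add: rest)
    qed
  qed
  ultimately show ?thesis by (rule that[rotated])
qed

text \<open>The weight of \<open>v\<close> cannot in general be read off at \<open>Old v\<close>,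
  since 1 - \<rho> may vanish. Any \<open>P u\<close> shows it, and if there is none, the factor at
  \<open>Old v\<close> is 1.\<close>

lemma fowler_weight_eq_iff:
  fixes f g :: "'a \<Rightarrow> 'k :: comm_ring_1"
  assumes v: "v \<in> pverts G"
  shows "(\<forall>w \<in> pverts (fowler G v). fowler_weight G v f w = fowler_weight G v g w) \<longleftrightarrow>
    (\<forall>w \<in> pverts G. f w = g w)" (is "?L \<longleftrightarrow> ?R")
proof
  assume L: ?L
  have "f v = g v"
  proof (cases "neighbours G v = {}")
    case True
    then show ?thesis using L v by (auto simp: pverts_fowler ball_Un)
  next
    case False
    then show ?thesis using L by (auto simp: pverts_fowler ball_Un)
  qed
  then show ?R using L by (auto simp: pverts_fowler ball_Un split: if_splits)
next
  assume ?R
  then show ?L using v neighbours_subset[of v] by (auto simp: pverts_fowler)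
qed

lemma nullity_fowler:
  assumes v: "v \<in> pverts G"
  shows "nullity G = nullity (fowler G v)"
proof (rule nullity_eq_if_null_weight_iso[OF pair_graph_axioms pair_graph_fowler[OF pair_graph_axioms v]])
  fix h :: "'a fowler_vertex \<Rightarrow> complex"
  assume "null_weight (fowler G v) h"
  then show "\<exists>f. null_weight G f \<and> (\<forall>w \<in> pverts (fowler G v). fowler_weight G v f w = h w)"
    using fowler_weight_surj[OF v] by metis
next
  fix f g :: "'a \<Rightarrow> complex"
  show "fowler_weight G v (\<lambda>w. f w + g w) = (\<lambda>w. fowler_weight G v f w + fowler_weight G v g w)"
  proof
    show "fowler_weight G v (\<lambda>w. f w + g w) w = fowler_weight G v f w + fowler_weight G v g w" for w
      by (cases w) (auto simp: algebra_simps)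
  qed
next
  fix c and f :: "'a \<Rightarrow> complex"
  show "fowler_weight G v (\<lambda>w. c * f w) = (\<lambda>w. c * fowler_weight G v f w)"
  proof
    show "fowler_weight G v (\<lambda>w. c * f w) w = c * fowler_weight G v f w" for w
      by (cases w) auto
  qed
qed (use null_weight_fowler_weight[OF v] fowler_weight_eq_iff[OF v] in blast)+

section \<open>Transfer of core vertices\<close>

text \<open>Coreness of all vertices is assumed because that of \<open>v\<close> alone does not pass
  to \<open>Old v\<close> when \<open>v\<close> has degree 1.\<close>

lemma core_vertex_fowlerI:
  assumes v: "v \<in> pverts G" and core: "\<And>w. w \<in> pverts G \<Longrightarrow> core_vertex G w"
    and x: "x \<in> pverts (fowler G v)"
  shows "core_vertex (fowler G v) x"
proof -
  interpret F: pair_graph "fowler G v" by (rule pair_graph_fowler[OF pair_graph_axioms v])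
  have ex: "\<exists>f :: 'a \<Rightarrow> real. null_weight G f \<and> f w \<noteq> 0" if "w \<in> pverts G" for w
    using core[OF that] core_vertex_iff by blast
  \<comment> \<open>With a single neighbour, the equation at \<open>v\<close> would make that
    neighbour's weight zero in every null weighting.\<close>
  have "card (neighbours G v) \<noteq> 1"
  proof
    assume "card (neighbours G v) = 1"
    then obtain u where u: "neighbours G v = {u}" by (auto simp: card_1_singleton_iff)
    then have "f u = 0" if "null_weight G f" for f :: "'a \<Rightarrow> real"
      using that v by (auto simp: null_weight_def)
    with u show False using ex[of u] neighbours_subset[of v] by auto
  qed
  then have deg: "1 - real (card (neighbours G v)) \<noteq> 0" by simp
  have "\<exists>f :: 'a \<Rightarrow> real. null_weight G f \<and> fowler_weight G v f x \<noteq> 0"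
  proof (cases x)
    case (Old w)
    then show ?thesis using ex[of w] x deg by (auto simp: pverts_fowler)
  next
    case (P u)
    then show ?thesis using ex[OF v] by simp
  next
    case (Q u)
    then show ?thesis using ex[of u] x neighbours_subset[of v] by (auto simp: pverts_fowler)
  qed
  then show ?thesis
    unfolding F.core_vertex_iff using x null_weight_fowler_weight[OF v] by blast
qed

text \<open>This direction works vertex by vertex: the weight at \<open>Old w\<close> is a multiple
  of \<open>f w\<close>, whatever the degree of \<open>v\<close>.\<close>

lemma core_vertex_fowlerD:
  assumes v: "v \<in> pverts G" and w: "w \<in> pverts G" and core: "core_vertex (fowler G v) (Old w)"
  shows "core_vertex G w"
proof -
  interpret F: pair_graph "fowler G v" by (rule pair_graph_fowler[OF pair_graph_axioms v])
  obtain g :: "'a fowler_vertex \<Rightarrow> real" where g: "null_weight (fowler G v) g" "g (Old w) \<noteq> 0"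
    using core F.core_vertex_iff by blast
  obtain f where f: "null_weight G f"
    "\<And>x. x \<in> pverts (fowler G v) \<Longrightarrow> fowler_weight G v f x = g x"
    using fowler_weight_surj[OF v g(1)] by blast
  have "fowler_weight G v f (Old w) \<noteq> 0"
    using f(2)[of "Old w"] g(2) w by (simp add: pverts_fowler)
  then have "f w \<noteq> 0" by (auto split: if_splits)
  with f(1) w show ?thesis using core_vertex_iff by blast
qed

end

theorem theorem3:
  fixes G :: "'a pair_pre_digraph" and v :: 'a
  assumes "pair_graph G" and "v \<in> pverts G"
  shows "(core_graph G \<longleftrightarrow> core_graph (fowler G v)) \<and> nullity G = nullity (fowler G v)"
proof -
  interpret pair_graph G by fact
  have "(\<forall>w \<in> pverts G. core_vertex G w) \<longleftrightarrow>
      (\<forall>x \<in> pverts (fowler G v). core_vertex (fowler G v) x)"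
    using core_vertex_fowlerI[OF assms(2)] core_vertex_fowlerD[OF assms(2)]
    by (auto simp: pverts_fowler)
  with nullity_fowler[OF assms(2)] show ?thesis by (simp add: core_graph_def)
qed

end
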